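(* Consider the RCP problem $$\min_{x\in\mathbb{R}^n} c^Tx\quad\text{s.t.}\quad g_i(x)\le 0,\ i=1,\dots,n_g;\qquad Cx=d, \qquad (\mathrm{RCP})$$ satisfying the assumptions B1--B4 of the context. If the global minimum $x^*$ is a strict local minimum of (RCP), then (RCP) is regular.
   Context: In (RCP), $c\in\mathbb{R}^n$, $g_i:\mathbb{R}^n\to\mathbb{R}$ are concave functions, $C\in\mathbb{R}^{n_C\times n}$ and $d\in\mathbb{R}^{n_C}$. Let $\mathcal{X}=\{x: g_i(x)\le 0,\ i=1,\dots,n_g;\ Cx=d\}$ denote the feasible domain, assumed nonempty. Assumptions. B1: each $g_i$ is concave and continuously differentiable over an open set containing $\mathcal{X}$. B2: the rank of $C$ is $n_C$, with $n_C<n$. B3: $c^Tx$ attains its global minimum over $\mathcal{X}$ at $x^*\in\mathcal{X}$. B4: the linear independence constraint qualification (LICQ) holds at $x^*$, i.e., the gradients $\nabla g_i(x^* )$ of the inequality constraints active at $x^*$ together with the rows of $C$ are linearly independent. Regularity. (RCP) is called regular if $$x^*=\arg\max_x\ c^Tx\quad\text{s.t.}\quad g_i(x)\ge 0\ \ \forall i\in i_{A^*};\qquad Cx=d,$$ where $i_{A^*}$ is the index set of $n-n_C$ inequality constraints that are active at $x^*$ (active: $g_i(x^* )=0$). *)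

theory Defs
  imports "HOL-Analysis.Analysis"
begin

text \<open>
  The matrix of the equality constraints is a family \<open>C\<close> of rows, \<open>C j\<close> for \<open>j \<in> {1..nC}\<close>, rather
  than a \<open>real ^ 'n ^ 'm\<close>: a type-indexed matrix has at least one row, which would exclude the
  case \<open>nC = 0\<close> of no equality constraints.
\<close>

definition eq_feasible :: "nat \<Rightarrow> (nat \<Rightarrow> real ^ 'n) \<Rightarrow> (nat \<Rightarrow> real) \<Rightarrow> (real ^ 'n) set" where
  "eq_feasible nC C d = {x. \<forall>j\<in>{1..nC}. C j \<bullet> x = d j}"

definition rcp_feasible ::
  "nat \<Rightarrow> (nat \<Rightarrow> real ^ 'n \<Rightarrow> real) \<Rightarrow> nat \<Rightarrow> (nat \<Rightarrow> real ^ 'n) \<Rightarrow> (nat \<Rightarrow> real) \<Rightarrow> (real ^ 'n) set" where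
  "rcp_feasible ng g nC C d = {x. \<forall>i\<in>{1..ng}. g i x \<le> 0} \<inter> eq_feasible nC C d"

text \<open>As for the library's \<^const>\<open>rank\<close>, the rank is the dimension of the set of rows.\<close>

definition rows_rank :: "nat \<Rightarrow> (nat \<Rightarrow> real ^ 'n) \<Rightarrow> nat" where
  "rows_rank nC C = dim (C ` {1..nC})"

definition active_set :: "nat \<Rightarrow> (nat \<Rightarrow> real ^ 'n \<Rightarrow> real) \<Rightarrow> real ^ 'n \<Rightarrow> nat set" where
  "active_set ng g x = {i \<in> {1..ng}. g i x = 0}"

text \<open>Unspecified where \<open>f\<close> is not differentiable.\<close>

definition gradient :: "(real ^ 'n \<Rightarrow> real) \<Rightarrow> real ^ 'n \<Rightarrow> real ^ 'n" where
  "gradient f x = (THE D. GDERIV f x :> D)"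

definition continuously_differentiable_on :: "(real ^ 'n) set \<Rightarrow> (real ^ 'n \<Rightarrow> real) \<Rightarrow> bool" where
  "continuously_differentiable_on U f \<longleftrightarrow>
     (\<forall>x\<in>U. f differentiable at x) \<and> continuous_on U (gradient f)"

text \<open>
  The gradients and rows must be independent as an indexed family, so a vector occurring twice
  counts as a dependence; hence the injectivity conjunct.
\<close>

definition licq ::
  "nat \<Rightarrow> (nat \<Rightarrow> real ^ 'n \<Rightarrow> real) \<Rightarrow> nat \<Rightarrow> (nat \<Rightarrow> real ^ 'n) \<Rightarrow> real ^ 'n \<Rightarrow> bool" where
  "licq ng g nC C x \<longleftrightarrow>
     (let v = case_sum (\<lambda>i. gradient (g i) x) C; I = active_set ng g x <+> {1..nC}
      in inj_on v I \<and> independent (v ` I))"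

definition strict_local_min_on :: "('a::metric_space) set \<Rightarrow> ('a \<Rightarrow> real) \<Rightarrow> 'a \<Rightarrow> bool" where
  "strict_local_min_on S f x \<longleftrightarrow>
     x \<in> S \<and> (\<exists>e>0. \<forall>y \<in> S \<inter> ball x e. y \<noteq> x \<longrightarrow> f x < f y)"

text \<open>
  Exactly \<open>n - nC\<close> inequality constraints are active at \<open>xs\<close>, and \<open>xs\<close> is the only maximizer
  of the problem in which these are reversed and the inactive ones are dropped.
\<close>

definition rcp_regular ::
  "real ^ 'n \<Rightarrow> nat \<Rightarrow> (nat \<Rightarrow> real ^ 'n \<Rightarrow> real) \<Rightarrow> nat \<Rightarrow> (nat \<Rightarrow> real ^ 'n) \<Rightarrow> (nat \<Rightarrow> real)
     \<Rightarrow> real ^ 'n \<Rightarrow> bool" where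
  "rcp_regular c ng g nC C d xs \<longleftrightarrow>
     card (active_set ng g xs) = CARD('n) - nC \<and>
     {x. is_arg_max (\<lambda>x. c \<bullet> x)
           (\<lambda>x. (\<forall>i\<in>active_set ng g xs. g i x \<ge> 0) \<and> x \<in> eq_feasible nC C d) x} = {xs}"

end

theory Submission
  imports Defs
begin

text \<open>
  A concave function lies below its tangent plane. Hence every direction \<open>h\<close> in the null space of
  \<open>C\<close> along which no active constraint increases to first order is feasible for small steps, so a
  strict local minimum forces \<open>c \<bullet> h > 0\<close> unless \<open>h = 0\<close>. If fewer than \<open>n - nC\<close> constraints were
  active, some \<open>h \<noteq> 0\<close> would be orthogonal to all their gradients and to the rows of \<open>C\<close>, and both
  \<open>h\<close> and \<open>- h\<close> would be such directions. If \<open>x \<noteq> xs\<close> is feasible for the reversed problem, then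
  by the tangent inequality \<open>xs - x\<close> is such a direction, so \<open>c \<bullet> x < c \<bullet> xs\<close>.
\<close>

text \<open>The derivative is a linear functional on a Euclidean space, so it is the inner product
  with \<open>adjoint f' 1\<close>. Uniqueness of derivatives makes this the only candidate for the
  definite description in \<open>gradient\<close>.\<close>

lemma GDERIV_gradient:
  fixes f :: "real ^ 'n \<Rightarrow> real"
  assumes "f differentiable at x"
  shows "GDERIV f x :> gradient f x"
proof -
  obtain f' where f': "(f has_derivative f') (at x)"
    using assms by (auto simp: differentiable_def)
  then have "linear f'"
    by (rule has_derivative_linear)
  then have "f' = (\<lambda>h. h \<bullet> adjoint f' 1)"
    using adjoint_works[of f' _ 1] by (auto simp: inner_real_def)
  then have D: "GDERIV f x :> adjoint f' 1"
    using f' by (simp add: gderiv_def)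
  have unique: "D' = adjoint f' 1" if "GDERIV f x :> D'" for D'
  proof -
    have "(\<lambda>h. h \<bullet> D') = (\<lambda>h. h \<bullet> adjoint f' 1)"
      using that D unfolding gderiv_def by (rule has_derivative_unique)
    then show ?thesis
      by (simp add: fun_eq_iff vector_eq_ldot)
  qed
  show ?thesis
    unfolding gradient_def using D unique by (rule theI)
qed

text \<open>Restricting \<open>- f\<close> to the line through \<open>x\<close> and \<open>y\<close>
  gives a convex function of one real variable, to which the one-dimensional tangent inequality
  applies.\<close>

lemma concave_on_le_tangent:
  fixes f :: "'a::real_inner \<Rightarrow> real"
  assumes concave: "concave_on UNIV f" and D: "GDERIV f x :> D"
  shows "f y \<le> f x + D \<bullet> (y - x)"
proof -
  let ?l = "\<lambda>t::real. x + t *\<^sub>R (y - x)"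
  let ?\<phi> = "\<lambda>t. - f (?l t)"
  have "convex_on UNIV ?\<phi>"
  proof (rule convex_onI)
    fix t s r :: real
    assume t: "0 < t" "t < 1"
    have l: "?l ((1 - t) *\<^sub>R s + t *\<^sub>R r) = (1 - t) *\<^sub>R ?l s + t *\<^sub>R ?l r"
      by (simp add: algebra_simps)
    have "convex_on UNIV (\<lambda>z. - f z)"
      using concave by (simp add: concave_on_def)
    then show "?\<phi> ((1 - t) *\<^sub>R s + t *\<^sub>R r) \<le> (1 - t) * ?\<phi> s + t * ?\<phi> r"
      unfolding l using t by (intro convex_onD) auto
  qed simp
  moreover have "(?\<phi> has_real_derivative - (D \<bullet> (y - x))) (at 0 within UNIV)"
  proof -
    have "(f has_derivative (\<lambda>h. h \<bullet> D)) (at (?l 0))"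
      using D by (simp add: gderiv_def)
    moreover have "(?l has_derivative (\<lambda>t. t *\<^sub>R (y - x))) (at 0)"
      by (auto intro!: derivative_eq_intros)
    ultimately have "((\<lambda>t. f (?l t)) has_derivative (\<lambda>t. (t *\<^sub>R (y - x)) \<bullet> D)) (at 0)"
      by (rule has_derivative_compose[rotated])
    then have "(?\<phi> has_derivative (\<lambda>t. - ((t *\<^sub>R (y - x)) \<bullet> D))) (at 0)"
      by (rule has_derivative_minus)
    then show ?thesis
      by (rule has_derivative_imp_has_field_derivative) (simp add: inner_commute)
  qed
  \<comment> \<open>The parameters 0 and 1 correspond to the points \<open>x\<close> and
    \<open>y\<close>.\<close>
  ultimately have "?\<phi> 1 - ?\<phi> 0 \<ge> - (D \<bullet> (y - x)) * (1 - 0)"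
    by (intro convex_on_imp_above_tangent[where A = UNIV]) auto
  then show ?thesis
    by simp
qed

text \<open>An active constraint stays below its tangent, which does not increase along
  \<open>h\<close>; concavity is thus what lets the non-strict first-order condition suffice. An
  inactive one stays negative for small steps by continuity, and finitely many such conditions hold
  eventually together.\<close>

lemma first_order_feasible_direction:
  fixes h xs :: "real ^ 'n"
  assumes concave: "\<And>i. i \<in> {1..ng} \<Longrightarrow> concave_on UNIV (g i)"
    and diff: "\<And>i. i \<in> {1..ng} \<Longrightarrow> g i differentiable at xs"
    and xs: "xs \<in> rcp_feasible ng g nC C d"
    and active: "\<And>i. i \<in> active_set ng g xs \<Longrightarrow> gradient (g i) xs \<bullet> h \<le> 0"
    and eq: "\<And>j. j \<in> {1..nC} \<Longrightarrow> C j \<bullet> h = 0"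
  shows "\<forall>\<^sub>F t in at_right 0. xs + t *\<^sub>R h \<in> rcp_feasible ng g nC C d"
proof -
  have "\<forall>\<^sub>F t in at_right 0. g i (xs + t *\<^sub>R h) \<le> 0" if i: "i \<in> {1..ng}" for i
  proof (cases "g i xs = 0")
    case True
    have "g i (xs + t *\<^sub>R h) \<le> 0" if "t > 0" for t
    proof -
      have "g i (xs + t *\<^sub>R h) \<le> g i xs + gradient (g i) xs \<bullet> (xs + t *\<^sub>R h - xs)"
        by (rule concave_on_le_tangent[OF concave[OF i] GDERIV_gradient[OF diff[OF i]]])
      also have "\<dots> = t * (gradient (g i) xs \<bullet> h)"
        using True by simp
      also have "\<dots> \<le> 0"
        using active[of i] i True \<open>t > 0\<close> by (simp add: active_set_def mult_nonneg_nonpos)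
      finally show ?thesis .
    qed
    then show ?thesis
      by (auto intro: eventually_at_right_less[THEN eventually_mono])
  next
    case False
    then have neg: "g i xs < 0"
      using xs i by (force simp: rcp_feasible_def)
    have "isCont (g i) (xs + 0 *\<^sub>R h)"
      using diff[OF i] by (simp add: differentiable_imp_continuous_within)
    moreover have "((\<lambda>t. xs + t *\<^sub>R h) \<longlongrightarrow> xs + 0 *\<^sub>R h) (at_right 0)"
      by (intro tendsto_intros)
    ultimately have "((\<lambda>t. g i (xs + t *\<^sub>R h)) \<longlongrightarrow> g i (xs + 0 *\<^sub>R h)) (at_right 0)"
      by (rule isCont_tendsto_compose)
    then have "\<forall>\<^sub>F t in at_right 0. g i (xs + t *\<^sub>R h) < 0"
      using neg by (intro order_tendstoD(2)) auto
    then show ?thesis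
      by (rule eventually_mono) simp
  qed
  then have "\<forall>\<^sub>F t in at_right 0. \<forall>i\<in>{1..ng}. g i (xs + t *\<^sub>R h) \<le> 0"
    by (simp add: eventually_ball_finite)
  then show ?thesis
    by (rule eventually_mono)
      (use xs eq in \<open>auto simp: rcp_feasible_def eq_feasible_def inner_add_right\<close>)
qed

text \<open>The objective is linear and changes by \<open>t * (c \<bullet> h)\<close>, so a single
  small feasible step already fixes the sign of \<open>c \<bullet> h\<close>.\<close>

lemma strict_local_min_on_feasible_direction:
  fixes x h c :: "'a::real_inner"
  assumes strict: "strict_local_min_on S (\<lambda>x. c \<bullet> x) x"
    and feas: "\<forall>\<^sub>F t in at_right 0. x + t *\<^sub>R h \<in> S"
    and "h \<noteq> 0"
  shows "c \<bullet> h > 0"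
proof -
  obtain e where "e > 0"
    and e: "\<And>y. y \<in> S \<Longrightarrow> y \<in> ball x e \<Longrightarrow> y \<noteq> x \<Longrightarrow> c \<bullet> x < c \<bullet> y"
    using strict unfolding strict_local_min_on_def by blast
  have "((\<lambda>t. x + t *\<^sub>R h) \<longlongrightarrow> x + 0 *\<^sub>R h) (at_right 0)"
    by (intro tendsto_intros)
  then have "\<forall>\<^sub>F t in at_right 0. x + t *\<^sub>R h \<in> ball x e"
    using \<open>e > 0\<close> by (intro topological_tendstoD) auto
  with feas have "\<forall>\<^sub>F t in at_right 0. t > 0 \<and> x + t *\<^sub>R h \<in> S \<and> x + t *\<^sub>R h \<in> ball x e"
    by (intro eventually_conj eventually_at_right_less)
  then obtain t :: real where t: "t > 0" "x + t *\<^sub>R h \<in> S" "x + t *\<^sub>R h \<in> ball x e"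
    using eventually_happens'[OF trivial_limit_at_right_real] by blast
  then have "c \<bullet> x < c \<bullet> (x + t *\<^sub>R h)"
    using e \<open>h \<noteq> 0\<close> by auto
  then show ?thesis
    using \<open>t > 0\<close> by (simp add: inner_add_right zero_less_mult_iff)
qed

theorem theorem2:
  fixes c :: "real ^ 'n"
    and g :: "nat \<Rightarrow> real ^ 'n \<Rightarrow> real" and ng :: nat
    and C :: "nat \<Rightarrow> real ^ 'n" and d :: "nat \<Rightarrow> real" and nC :: nat
    and xs :: "real ^ 'n"
  assumes nonempty: "rcp_feasible ng g nC C d \<noteq> {}"
    and concave: "\<And>i. i \<in> {1..ng} \<Longrightarrow> concave_on UNIV (g i)"
    and smooth: "\<And>i. i \<in> {1..ng} \<Longrightarrow>
      \<exists>U. open U \<and> rcp_feasible ng g nC C d \<subseteq> U \<and> continuously_differentiable_on U (g i)"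
    and rank: "rows_rank nC C = nC" "nC < CARD('n)"
    and global_min: "is_arg_min (\<lambda>x. c \<bullet> x) (\<lambda>x. x \<in> rcp_feasible ng g nC C d) xs"
    and licq: "licq ng g nC C xs"
    and strict: "strict_local_min_on (rcp_feasible ng g nC C d) (\<lambda>x. c \<bullet> x) xs"
  shows "rcp_regular c ng g nC C d xs"
proof -
  let ?S = "rcp_feasible ng g nC C d" and ?A = "active_set ng g xs"
  have xs: "xs \<in> ?S"
    using strict by (simp add: strict_local_min_on_def)
  have diff: "g i differentiable at xs" if "i \<in> {1..ng}" for i
    using smooth[OF that] xs unfolding continuously_differentiable_on_def by blast
  \<comment> \<open>This is applied to three directions: \<open>h\<close> and \<open>- h\<close>
    when counting active constraints, and \<open>xs - x\<close> when comparing with a competitor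
    \<open>x\<close>.\<close>
  have descent: "c \<bullet> h > 0"
    if "h \<noteq> 0" "\<And>i. i \<in> ?A \<Longrightarrow> gradient (g i) xs \<bullet> h \<le> 0"
      "\<And>j. j \<in> {1..nC} \<Longrightarrow> C j \<bullet> h = 0" for h
    using strict_local_min_on_feasible_direction[OF strict]
      first_order_feasible_direction[OF concave diff xs] that by blast
  have card: "card ?A = CARD('n) - nC"
  proof -
    define v where "v = case_sum (\<lambda>i. gradient (g i) xs) C"
    define V where "V = v ` (?A <+> {1..nC})"
    have inj: "inj_on v (?A <+> {1..nC})" and indep: "independent V"
      using licq by (simp_all add: licq_def Let_def v_def V_def)
    have "finite ?A"
      by (simp add: active_set_def)
    \<comment> \<open>Injectivity of the family ensures that no vector is lost in passing to the set
      \<open>V\<close>. Since \<open>V\<close> is independent, it remains to show that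
      \<open>V\<close> has full dimension.\<close>
    then have card_V: "card V = card ?A + nC"
      using inj by (simp add: V_def card_image card_Plus)
    have "\<not> dim V < CARD('n)"
    proof
      assume "dim V < CARD('n)"
      \<comment> \<open>\<open>h\<close> is a normal vector of a hyperplane containing the span of
        \<open>V\<close>.\<close>
      then obtain h where "h \<noteq> 0" and h: "span V \<subseteq> {x. h \<bullet> x = 0}"
        using lowdim_subset_hyperplane[of V] by auto
      have orth: "w \<bullet> h = 0" if "w \<in> V" for w
        using h span_base[OF that] by (auto simp: inner_commute)
      have "gradient (g i) xs \<in> V" if "i \<in> ?A" for i
        using that unfolding V_def v_def by (force intro: rev_image_eqI[where x = "Inl i"])
      moreover have "C j \<in> V" if "j \<in> {1..nC}" for j
        using that unfolding V_def v_def by (force intro: rev_image_eqI[where x = "Inr j"])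
      ultimately have "\<forall>i\<in>?A. gradient (g i) xs \<bullet> h = 0" "\<forall>j\<in>{1..nC}. C j \<bullet> h = 0"
        using orth by blast+
      then have "c \<bullet> h > 0" and "c \<bullet> - h > 0"
        using \<open>h \<noteq> 0\<close> descent[of h] descent[of "- h"] by simp_all
      then show False
        by simp
    qed
    moreover have "dim V \<le> CARD('n)"
      using dim_subset_UNIV[of V] by simp
    ultimately show ?thesis
      using card_V dim_eq_card_independent[OF indep] by simp
  qed
  let ?P = "\<lambda>x. (\<forall>i\<in>?A. g i x \<ge> 0) \<and> x \<in> eq_feasible nC C d"
  have P_xs: "?P xs"
    using xs by (simp add: active_set_def rcp_feasible_def)
  have less: "c \<bullet> x < c \<bullet> xs" if x: "?P x" "x \<noteq> xs" for x
  proof -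
    \<comment> \<open>The tangent inequality at \<open>xs\<close>, evaluated at \<open>x\<close>,
      reads \<open>0 \<le> g i x \<le> gradient (g i) xs \<bullet> (x - xs)\<close>.\<close>
    have "gradient (g i) xs \<bullet> (xs - x) \<le> 0" if "i \<in> ?A" for i
    proof -
      have i: "i \<in> {1..ng}" and "g i xs = 0"
        using that by (auto simp: active_set_def)
      moreover have "g i x \<ge> 0"
        using x that by blast
      ultimately show ?thesis
        using concave_on_le_tangent[OF concave[OF i] GDERIV_gradient[OF diff[OF i]], of x]
        by (simp add: inner_diff_right)
    qed
    moreover have "C j \<bullet> (xs - x) = 0" if "j \<in> {1..nC}" for j
      using x P_xs that by (simp add: eq_feasible_def inner_diff_right)
    ultimately have "c \<bullet> (xs - x) > 0"
      using x by (intro descent) auto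
    then show ?thesis
      by (simp add: inner_diff_right)
  qed
  have "is_arg_max (\<lambda>x. c \<bullet> x) ?P x \<longleftrightarrow> x = xs" for x
  proof
    assume "is_arg_max (\<lambda>x. c \<bullet> x) ?P x"
    then have "?P x" and "\<not> c \<bullet> x < c \<bullet> xs"
      using P_xs unfolding is_arg_max_def by blast+
    then show "x = xs"
      using less by blast
  next
    assume "x = xs"
    moreover have "\<not> c \<bullet> xs < c \<bullet> y" if "?P y" for y
      using less[OF that] by (cases "y = xs") auto
    ultimately show "is_arg_max (\<lambda>x. c \<bullet> x) ?P x"
      using P_xs unfolding is_arg_max_def by blast
  qed
  then have "{x. is_arg_max (\<lambda>x. c \<bullet> x) ?P x} = {xs}"
    by blast
  with card show ?thesis
    by (simp add: rcp_regular_def)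
qed

end
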